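(* Let $\mathbb{F}$ be an arbitrary field, $n\ge1$, and for $1\le i\le n$ let $\prec_i$ be an elimination order with respect to $x_i$ on the monomials of $\mathbb{F}[x_1,\dots,x_n]$. Then for any zero dimensional ideal $I\trianglelefteq\mathbb{F}[x_1,\dots,x_n]$, the set of standard monomials of $I$ is the same for every term order if and only if it is the same for $\prec_1,\dots,\prec_n$.
   Context: An ideal $I\trianglelefteq\mathbb{F}[x_1,\dots,x_n]$ is zero dimensional if $\mathbb{F}[x_1,\dots,x_n]/I$ is a finite dimensional $\mathbb{F}$-vector space. A term order is a total order on monomials with $1$ minimal and compatible with multiplication by monomials. The leading monomial of a nonzero polynomial is its largest monomial (w.r.t. the term order) with nonzero coefficient; a standard monomial of $I$ is a monomial that is not the leading monomial of any nonzero element of $I$. A term order is an elimination order with respect to $x_i$ if $x_i$ is larger than every monomial of $\mathbb{F}[x_1,\dots,x_{i-1},x_{i+1},\dots,x_n]$. *)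

theory Defs
  imports Complex_Main "HOL-Library.Poly_Mapping" "HOL-Library.Set_Algebras"
begin

text \<open>
  The variables are indexed by a finite type \<open>'n\<close>, so their number is \<open>n = CARD('n) \<ge> 1\<close>.
  A monomial is its exponent vector; the monomial \<open>1\<close> is \<open>0\<close>, and multiplication of monomials
  is addition of exponent vectors.  The product of \<open>poly_mapping\<close> is convolution, so
  \<open>('n, 'a) mpol\<close> is the polynomial ring over \<open>'a\<close> in the variables \<open>'n\<close>.
\<close>

type_synonym 'n monom = "'n \<Rightarrow>\<^sub>0 nat"

type_synonym ('n, 'a) mpol = "'n monom \<Rightarrow>\<^sub>0 'a"

abbreviation var :: "'n \<Rightarrow> 'n monom"
  where "var i \<equiv> Poly_Mapping.single i 1"

definition poly_ideal :: "('n, 'a::field) mpol set \<Rightarrow> bool"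
  where "poly_ideal I \<longleftrightarrow>
    0 \<in> I \<and> (\<forall>p\<in>I. \<forall>q\<in>I. p + q \<in> I) \<and> (\<forall>p. \<forall>q\<in>I. p * q \<in> I)"

definition smult :: "'a::field \<Rightarrow> ('n, 'a) mpol \<Rightarrow> ('n, 'a) mpol"
  where "smult c p = Poly_Mapping.single 0 c * p"

global_interpretation mpol: vector_space smult
proof
  fix a b :: 'a and x y :: "('n, 'a) mpol"
  show "smult a (x + y) = smult a x + smult a y"
    by (simp add: smult_def distrib_left)
  show "smult (a + b) x = smult a x + smult b x"
    by (simp add: smult_def single_add distrib_right)
  show "smult a (smult b x) = smult (a * b) x"
    by (simp add: smult_def mult.assoc [symmetric] mult_single)
  show "smult 1 x = x"
    by (simp add: smult_def)
qed

definition quotient_ring :: "('n, 'a::field) mpol set \<Rightarrow> ('n, 'a) mpol set set"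
  where "quotient_ring I = (\<lambda>p. p +o I) ` UNIV"

text \<open>
  The projection \<open>p \<mapsto> p + I\<close> is linear, so the image of \<open>mpol.span B\<close> below is the linear span,
  inside the quotient, of the residue classes of the elements of \<open>B\<close>.  The condition thus says
  that finitely many residue classes span the quotient.  The unit ideal is included.
\<close>

definition zero_dimensional :: "('n, 'a::field) mpol set \<Rightarrow> bool"
  where "zero_dimensional I \<longleftrightarrow>
    (\<exists>B. finite B \<and> quotient_ring I = (\<lambda>p. p +o I) ` mpol.span B)"

text \<open>\<open>(s, t) \<in> r\<close> means that \<open>s\<close> is smaller than or equal to \<open>t\<close>.\<close>

definition term_order :: "'n monom rel \<Rightarrow> bool"
  where "term_order r \<longleftrightarrow>
    linear_order r \<and> (\<forall>t. (0, t) \<in> r) \<and> (\<forall>s t u. (s, t) \<in> r \<longrightarrow> (s + u, t + u) \<in> r)"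

text \<open>Subtracting \<open>Id\<close> yields the strict order.\<close>

definition elimination_order :: "'n \<Rightarrow> 'n monom rel \<Rightarrow> bool"
  where "elimination_order i r \<longleftrightarrow>
    term_order r \<and> (\<forall>t. Poly_Mapping.lookup t i = 0 \<longrightarrow> (t, var i) \<in> r - Id)"

text \<open>Only meaningful for a term order \<open>r\<close> and \<open>p \<noteq> 0\<close>.\<close>

definition lead_monom :: "'n monom rel \<Rightarrow> ('n, 'a::field) mpol \<Rightarrow> 'n monom"
  where "lead_monom r p =
    (THE t. t \<in> Poly_Mapping.keys p \<and> (\<forall>s\<in>Poly_Mapping.keys p. (s, t) \<in> r))"

definition standard_monoms :: "'n monom rel \<Rightarrow> ('n, 'a::field) mpol set \<Rightarrow> 'n monom set"
  where "standard_monoms r I = {t. \<not> (\<exists>p\<in>I. p \<noteq> 0 \<and> lead_monom r p = t)}"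

end

theory Submission
  imports Defs
begin

text \<open>
  Let \<open>S\<close> be the common set of standard monomials for the given elimination orders.  Every monomial
  \<open>w\<close> is congruent modulo \<open>I\<close> to a polynomial \<open>h\<close> supported on \<open>S\<close>.  If \<open>w \<notin> S\<close>, then for each of
  the orders the leading monomial of \<open>w - h\<close> is outside \<open>S\<close>, so it is \<open>w\<close>.  A smaller monomial for
  an elimination order with respect to \<open>x\<^sub>i\<close> has at most the same degree in \<open>x\<^sub>i\<close>.  Hence all monomials
  of \<open>h\<close> divide \<open>w\<close>, and \<open>w\<close> is the leading monomial of \<open>w - h\<close> for every term order.  Conversely,
  if \<open>t \<in> S\<close> were the leading monomial of some \<open>p \<in> I\<close> for a term order, replacing each monomial of
  \<open>p\<close> by its normal form would keep the coefficient of \<open>t\<close>, because \<open>t\<close> divides no smaller monomial;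
  this gives a nonzero element of \<open>I\<close> supported on \<open>S\<close>, which is absurd.
\<close>

section \<open>Monotone subsequences of exponent vectors\<close>

lemma nat_incseq_subseq:
  fixes f :: "nat \<Rightarrow> nat"
  shows "\<exists>k. strict_mono k \<and> incseq (f \<circ> k)"
proof -
  obtain k :: "nat \<Rightarrow> nat" where k: "strict_mono k" "monoseq (\<lambda>n. f (k n))"
    using seq_monosub by blast
  show ?thesis
  proof (cases "incseq (f \<circ> k)")
    case False
    then have dec: "decseq (f \<circ> k)"
      using k(2) by (auto simp: monoseq_iff comp_def)
    \<comment> \<open>A nonincreasing sequence of naturals is constant once it attains its minimum
      \<open>m\<close>, so its tail from there is also nondecreasing.\<close>
    define m where "m = (LEAST m. m \<in> range (f \<circ> k))"
    have "m \<in> range (f \<circ> k)"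
      unfolding m_def by (rule LeastI_ex) blast
    then obtain n where n: "m = (f \<circ> k) n" by blast
    have "(f \<circ> k) j = m" if "j \<ge> n" for j
    proof (rule antisym)
      show "(f \<circ> k) j \<le> m" using dec that n by (simp add: decseq_def)
      show "m \<le> (f \<circ> k) j" unfolding m_def by (rule Least_le) blast
    qed
    then have "incseq (f \<circ> (\<lambda>j. k (n + j)))"
      by (simp add: incseq_def)
    moreover have "strict_mono (\<lambda>j. k (n + j))"
      using k(1) by (simp add: strict_mono_def)
    ultimately show ?thesis by blast
  qed (use k in blast)
qed

text \<open>Dickson's lemma in sequence form. The coordinates are treated one at a time: thinning
  out the sequence further keeps the coordinates already treated monotone.\<close>

lemma incseq_subseq_finite:
  fixes f :: "nat \<Rightarrow> 'b \<Rightarrow> nat"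
  assumes "finite A"
  shows "\<exists>k. strict_mono k \<and> (\<forall>a\<in>A. incseq (\<lambda>n. f (k n) a))"
  using assms
proof (induction A)
  case empty
  show ?case using strict_mono_id by blast
next
  case (insert x A)
  then obtain k where k: "strict_mono k" "\<forall>a\<in>A. incseq (\<lambda>n. f (k n) a)" by blast
  obtain l where l: "strict_mono l" "incseq ((\<lambda>n. f (k n) x) \<circ> l)"
    using nat_incseq_subseq by blast
  have "incseq (\<lambda>n. f (k (l n)) a)" if "a \<in> A" for a
    using k(2) l(1) that by (simp add: incseq_def strict_mono_less_eq)
  moreover have "strict_mono (k \<circ> l)"
    using k(1) l(1) by (rule strict_mono_o)
  ultimately show ?case
    using l(2) by (intro exI[of _ "k \<circ> l"]) (simp add: comp_def)
qed

section \<open>Term orders and elimination orders\<close>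

lemma term_order_antisym: "term_order r \<Longrightarrow> (s, t) \<in> r \<Longrightarrow> (t, s) \<in> r \<Longrightarrow> s = t"
  unfolding term_order_def order_on_defs by (meson antisymD)

lemma term_order_trans: "term_order r \<Longrightarrow> (s, t) \<in> r \<Longrightarrow> (t, u) \<in> r \<Longrightarrow> (s, u) \<in> r"
  unfolding term_order_def order_on_defs by (meson transD)

lemma term_order_refl: "term_order r \<Longrightarrow> (s, s) \<in> r"
  by (auto simp: term_order_def order_on_defs refl_on_def)

lemma term_order_total: "term_order r \<Longrightarrow> (s, t) \<in> r \<or> (t, s) \<in> r"
  using term_order_refl[of r s]
  by (cases "s = t") (auto simp: term_order_def order_on_defs total_on_def)

lemma term_order_add: "term_order r \<Longrightarrow> (s, t) \<in> r \<Longrightarrow> (s + u, t + u) \<in> r"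
  by (simp add: term_order_def)

text \<open>Divisibility makes the truncated difference \<open>t - s\<close> an exact quotient, and
  \<open>0\<close> below \<open>t - s\<close> can be multiplied by \<open>s\<close>.\<close>

lemma term_order_dvd:
  assumes "term_order r" and "\<And>i. Poly_Mapping.lookup s i \<le> Poly_Mapping.lookup t i"
  shows "(s, t) \<in> r"
proof -
  have "t - s + s = t"
    using assms(2) by (intro poly_mapping_eqI) (simp add: lookup_add lookup_minus)
  moreover have "(0, t - s) \<in> r"
    using assms(1) by (simp add: term_order_def)
  ultimately show ?thesis
    using term_order_add[OF assms(1), of 0 "t - s" s] by simp
qed

text \<open>In a strictly descending chain some term would divide a later one by Dickson's lemma. It
  would then lie below that later term, hence below its own successor in the chain.\<close>

lemma wf_term_order:
  fixes r :: "'n::finite monom rel"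
  assumes "term_order r"
  shows "wf (r - Id)"
  unfolding wf_iff_no_infinite_down_chain
proof
  assume "\<exists>f. \<forall>i. (f (Suc i), f i) \<in> r - Id"
  then obtain f where f: "\<And>i. (f (Suc i), f i) \<in> r - Id" by blast
  have desc: "(f (i + n), f i) \<in> r" for i n
  proof (induction n)
    case (Suc n)
    have "(f (i + Suc n), f (i + n)) \<in> r" using f[of "i + n"] by simp
    then show ?case using Suc by (rule term_order_trans[OF assms])
  qed (simp add: term_order_refl[OF assms])
  obtain k :: "nat \<Rightarrow> nat" where k: "strict_mono k"
    "\<And>a. incseq (\<lambda>n. Poly_Mapping.lookup (f (k n)) a)"
    using incseq_subseq_finite[of UNIV "\<lambda>n. Poly_Mapping.lookup (f n)"] by auto
  obtain n where n: "k 1 = Suc (k 0) + n"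
    using k(1) less_iff_Suc_add[of "k 0" "k 1"] by (auto simp: strict_mono_def)
  have "(f (k 0), f (k 1)) \<in> r"
    using k(2) by (intro term_order_dvd assms) (simp add: incseq_def)
  then have "(f (k 0), f (Suc (k 0))) \<in> r"
    using desc[of "Suc (k 0)" n] n term_order_trans[OF assms] by metis
  then show False
    using f[of "k 0"] term_order_antisym[OF assms] by blast
qed

text \<open>Suppose \<open>s\<close> has the larger degree in \<open>i\<close>. Cancelling the full
  power \<open>m\<close> of the variable in \<open>w\<close> leaves \<open>w - m\<close> free of it,
  so \<open>w - m\<close> is below \<open>var i\<close>, which divides \<open>s - m\<close>.
  Multiplying back by \<open>m\<close> puts \<open>w\<close> below \<open>s\<close>, hence
  \<open>w = s\<close>.\<close>

lemma elimination_order_degree: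
  assumes "elimination_order i r" and "(s, w) \<in> r"
  shows "Poly_Mapping.lookup s i \<le> Poly_Mapping.lookup w i"
proof (rule ccontr)
  assume less: "\<not> ?thesis"
  have r: "term_order r" using assms(1) by (simp add: elimination_order_def)
  define m where "m = Poly_Mapping.single i (Poly_Mapping.lookup w i)"
  have "Poly_Mapping.lookup (w - m) i = 0"
    by (simp add: m_def lookup_minus)
  then have "(w - m, var i) \<in> r"
    using assms(1) by (simp add: elimination_order_def)
  moreover have "(var i, s - m) \<in> r"
    using less by (intro term_order_dvd r) (auto simp: m_def lookup_minus lookup_single when_def)
  ultimately have "(w - m + m, s - m + m) \<in> r"
    using term_order_trans[OF r] term_order_add[OF r] by blast
  moreover have "w - m + m = w" "s - m + m = s"
    using less
    by (auto intro!: poly_mapping_eqI simp: m_def lookup_add lookup_minus lookup_single when_def)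
  ultimately have "s = w"
    using term_order_antisym[OF r assms(2)] by simp
  then show False using less by simp
qed

section \<open>Leading monomials and linear combinations modulo an ideal\<close>

lemma lead_monom_eqI:
  assumes "term_order r" and "t \<in> Poly_Mapping.keys p"
    and "\<And>s. s \<in> Poly_Mapping.keys p \<Longrightarrow> (s, t) \<in> r"
  shows "lead_monom r p = t"
  unfolding lead_monom_def
  using assms term_order_antisym[OF assms(1)] by (intro the_equality) blast+

lemma lead_monom_max:
  assumes r: "term_order r" and "p \<noteq> 0"
  shows "lead_monom r p \<in> Poly_Mapping.keys p"
    and "s \<in> Poly_Mapping.keys p \<Longrightarrow> (s, lead_monom r p) \<in> r"
proof -
  have "\<exists>t\<in>A. \<forall>s\<in>A. (s, t) \<in> r" if "finite A" "A \<noteq> {}" for A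
    using that
  proof (induction A rule: finite_ne_induct)
    case (singleton x)
    then show ?case using term_order_refl[OF r] by simp
  next
    case (insert x A)
    then obtain t where t: "t \<in> A" "\<forall>s\<in>A. (s, t) \<in> r" by blast
    show ?case
    proof (cases "(x, t) \<in> r")
      case True
      then show ?thesis using t by blast
    next
      case False
      then have "(t, x) \<in> r" using term_order_total[OF r] by blast
      then have "\<forall>s\<in>insert x A. (s, x) \<in> r"
        using t(2) term_order_refl[OF r] term_order_trans[OF r] by blast
      then show ?thesis by blast
    qed
  qed
  from this[of "Poly_Mapping.keys p"] obtain t
    where t: "t \<in> Poly_Mapping.keys p" "\<forall>s\<in>Poly_Mapping.keys p. (s, t) \<in> r"
    using assms(2) by auto
  then have "lead_monom r p = t" by (intro lead_monom_eqI r) auto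
  then show "lead_monom r p \<in> Poly_Mapping.keys p"
    and "s \<in> Poly_Mapping.keys p \<Longrightarrow> (s, lead_monom r p) \<in> r"
    using t by auto
qed

lemma lookup_smult: "Poly_Mapping.lookup (smult c p) t = c * Poly_Mapping.lookup p t"
proof -
  have "smult c p = Poly_Mapping.map ((*) c) p"
    by (simp add: smult_def mult_map_scale_conv_mult)
  then show ?thesis by (simp add: map.rep_eq when_def)
qed

lemma poly_mapping_eq_sum_smult:
  "p = (\<Sum>w\<in>Poly_Mapping.keys p. smult (Poly_Mapping.lookup p w) (Poly_Mapping.single w 1))"
  by (rule poly_mapping_eqI)
    (auto simp: lookup_sum lookup_smult lookup_single when_def in_keys_iff if_distrib sum.delta
      cong: if_cong)

lemma poly_ideal_smult: "poly_ideal I \<Longrightarrow> p \<in> I \<Longrightarrow> smult c p \<in> I"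
  by (simp add: poly_ideal_def smult_def)

lemma poly_ideal_diff:
  assumes "poly_ideal I" and "p \<in> I" and "q \<in> I"
  shows "p - q \<in> I"
proof -
  have "p + smult (- 1) q \<in> I"
    using assms(1,2) poly_ideal_smult[OF assms(1,3)] by (simp add: poly_ideal_def del: mpol.scale_minus_left)
  then show ?thesis by simp
qed

lemma poly_ideal_sum: "poly_ideal I \<Longrightarrow> (\<And>x. x \<in> A \<Longrightarrow> f x \<in> I) \<Longrightarrow> sum f A \<in> I"
  by (induction A rule: infinite_finite_induct) (auto simp: poly_ideal_def)

text \<open>Congruence modulo \<open>I\<close> is linear, so replacements chosen for single
  monomials extend to whole polynomials.\<close>

lemma poly_ideal_diff_sum_smult:
  assumes "poly_ideal I"
    and "\<And>w. w \<in> Poly_Mapping.keys p \<Longrightarrow> Poly_Mapping.single w 1 - h w \<in> I"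
  shows "p - (\<Sum>w\<in>Poly_Mapping.keys p. smult (Poly_Mapping.lookup p w) (h w)) \<in> I"
proof -
  let ?s = "\<Sum>w\<in>Poly_Mapping.keys p. smult (Poly_Mapping.lookup p w) (h w)"
  \<comment> \<open>\<open>arg_cong\<close> confines the expansion to the first \<open>p\<close>,
    since \<open>p\<close> also occurs inside \<open>?s\<close>.\<close>
  have "p - ?s =
    (\<Sum>w\<in>Poly_Mapping.keys p. smult (Poly_Mapping.lookup p w) (Poly_Mapping.single w 1)) - ?s"
    by (rule arg_cong[where f = "\<lambda>x. x - ?s", OF poly_mapping_eq_sum_smult])
  also have "\<dots> =
    (\<Sum>w\<in>Poly_Mapping.keys p. smult (Poly_Mapping.lookup p w) (Poly_Mapping.single w 1 - h w))"
    by (simp only: mpol.scale_right_diff_distrib sum_subtractf)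
  also have "\<dots> \<in> I"
    using assms by (intro poly_ideal_sum poly_ideal_smult) auto
  finally show ?thesis .
qed

lemma keys_sum_smult:
  assumes "\<And>w. w \<in> A \<Longrightarrow> Poly_Mapping.keys (h w) \<subseteq> S"
  shows "Poly_Mapping.keys (\<Sum>w\<in>A. smult (c w) (h w)) \<subseteq> S"
proof
  fix t assume "t \<in> Poly_Mapping.keys (\<Sum>w\<in>A. smult (c w) (h w))"
  then have "(\<Sum>w\<in>A. c w * Poly_Mapping.lookup (h w) t) \<noteq> 0"
    by (simp add: in_keys_iff lookup_sum lookup_smult)
  then obtain w where "w \<in> A" "c w * Poly_Mapping.lookup (h w) t \<noteq> 0"
    by (rule sum.not_neutral_contains_not_neutral)
  then show "t \<in> S" using assms[of w] by (auto simp: subset_iff in_keys_iff)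
qed

section \<open>Normal forms\<close>

lemma ex_normal_form_monom:
  fixes I :: "('n::finite, 'a::field) mpol set"
  assumes r: "term_order r" and I: "poly_ideal I"
  shows "\<exists>h. Poly_Mapping.keys h \<subseteq> standard_monoms r I \<and> Poly_Mapping.single w 1 - h \<in> I"
proof (induction w rule: wf_induct_rule[OF wf_term_order[OF r]])
  case (1 w)
  show ?case
  proof (cases "w \<in> standard_monoms r I")
    case True
    then show ?thesis
      using I by (intro exI[of _ "Poly_Mapping.single w 1"]) (simp add: poly_ideal_def)
  next
    case False
    then obtain p where p: "p \<in> I" "p \<noteq> 0" "lead_monom r p = w"
      by (auto simp: standard_monoms_def)
    have w: "Poly_Mapping.lookup p w \<noteq> 0"
      using lead_monom_max(1)[OF r p(2)] p(3) by (simp add: in_keys_iff)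
    \<comment> \<open>\<open>p'\<close> is \<open>p\<close> made monic, so \<open>w\<close> cancels
      in \<open>q\<close>. Thus \<open>w\<close> is congruent to \<open>q\<close> modulo
      \<open>I\<close>, and all monomials of \<open>q\<close> are smaller than \<open>w\<close> and
      have normal forms by induction.\<close>
    define p' where "p' = smult (inverse (Poly_Mapping.lookup p w)) p"
    define q where "q = Poly_Mapping.single w 1 - p'"
    have "\<exists>h. Poly_Mapping.keys h \<subseteq> standard_monoms r I \<and> Poly_Mapping.single s 1 - h \<in> I"
      if s: "s \<in> Poly_Mapping.keys q" for s
    proof (rule 1)
      have "s \<noteq> w"
        using s w by (auto simp: q_def p'_def in_keys_iff lookup_minus lookup_smult)
      moreover have "s \<in> Poly_Mapping.keys p"
        using s \<open>s \<noteq> w\<close>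
        by (auto simp: q_def p'_def in_keys_iff lookup_minus lookup_smult lookup_single when_def)
      ultimately show "(s, w) \<in> r - Id"
        using lead_monom_max(2)[OF r p(2)] p(3) by auto
    qed
    then obtain h where h: "\<And>s. s \<in> Poly_Mapping.keys q \<Longrightarrow>
        Poly_Mapping.keys (h s) \<subseteq> standard_monoms r I \<and> Poly_Mapping.single s 1 - h s \<in> I"
      by metis
    let ?h = "\<Sum>s\<in>Poly_Mapping.keys q. smult (Poly_Mapping.lookup q s) (h s)"
    have "p' + (q - ?h) \<in> I"
      using I h poly_ideal_diff_sum_smult[OF I, of q h] poly_ideal_smult[OF I p(1)]
      unfolding p'_def by (simp add: poly_ideal_def)
    then have "Poly_Mapping.single w 1 - ?h \<in> I"
      by (simp add: q_def)
    moreover have "Poly_Mapping.keys ?h \<subseteq> standard_monoms r I"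
      using h by (intro keys_sum_smult) blast
    ultimately show ?thesis by blast
  qed
qed

text \<open>The leading monomial of a nonzero such \<open>p\<close> would be standard. This is the
  linear independence of the standard monomials modulo \<open>I\<close>.\<close>

lemma standard_monoms_keysD:
  assumes "term_order r" and "p \<in> I" and "Poly_Mapping.keys p \<subseteq> standard_monoms r I"
  shows "p = 0"
  using lead_monom_max(1)[OF assms(1), of p] assms(2,3) by (auto simp: standard_monoms_def)

text \<open>The hypotheses on \<open>h\<close> and \<open>S\<close> do not mention \<open>r\<close>.
  The order enters only through the fact that a divisor of a monomial is never larger, which every
  term order satisfies.\<close>

lemma standard_monoms_eq_if_divisible_normal_forms:
  fixes I :: "('n, 'a::field) mpol set"
  assumes r: "term_order r" and I: "poly_ideal I"
    and keys: "\<And>w. Poly_Mapping.keys (h w) \<subseteq> S"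
    and cong: "\<And>w. Poly_Mapping.single w 1 - h w \<in> I"
    and fixed: "\<And>w. w \<in> S \<Longrightarrow> h w = Poly_Mapping.single w 1"
    and dvd: "\<And>w s i. s \<in> Poly_Mapping.keys (h w) \<Longrightarrow>
      Poly_Mapping.lookup s i \<le> Poly_Mapping.lookup w i"
    and indep: "\<And>p. p \<in> I \<Longrightarrow> Poly_Mapping.keys p \<subseteq> S \<Longrightarrow> p = 0"
  shows "standard_monoms r I = S"
proof (intro equalityI subsetI)
  fix w assume w: "w \<in> standard_monoms r I"
  show "w \<in> S"
  proof (rule ccontr)
    assume "w \<notin> S"
    then have "Poly_Mapping.lookup (h w) w = 0"
      using keys[of w] by (auto simp: in_keys_iff)
    then have "w \<in> Poly_Mapping.keys (Poly_Mapping.single w 1 - h w)"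
      by (simp add: in_keys_iff lookup_minus)
    moreover have "(s, w) \<in> r" if "s \<in> Poly_Mapping.keys (Poly_Mapping.single w 1 - h w)" for s
    proof (cases "s = w")
      case False
      then have "s \<in> Poly_Mapping.keys (h w)"
        using that by (auto simp: in_keys_iff lookup_minus lookup_single when_def)
      then show ?thesis using dvd by (intro term_order_dvd r)
    qed (simp add: term_order_refl[OF r])
    ultimately have "lead_monom r (Poly_Mapping.single w 1 - h w) = w"
      "Poly_Mapping.single w 1 - h w \<noteq> 0"
      by (auto intro: lead_monom_eqI[OF r])
    then show False using w cong[of w] by (auto simp: standard_monoms_def)
  qed
next
  fix t assume t: "t \<in> S"
  show "t \<in> standard_monoms r I"
  proof (rule ccontr)
    assume "t \<notin> standard_monoms r I"
    then obtain p where p: "p \<in> I" "p \<noteq> 0" "lead_monom r p = t"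
      by (auto simp: standard_monoms_def)
    define q where "q = (\<Sum>w\<in>Poly_Mapping.keys p. smult (Poly_Mapping.lookup p w) (h w))"
    have t_key: "t \<in> Poly_Mapping.keys p"
      using lead_monom_max(1)[OF r p(2)] p(3) by simp
    \<comment> \<open>If \<open>t\<close> occurred in \<open>h w\<close>, it would divide
      \<open>w\<close> and so be at most \<open>w\<close>, although \<open>w\<close> is a monomial
      of \<open>p\<close> other than its leading one \<open>t\<close>. So only \<open>h t\<close>,
      which is \<open>t\<close> itself, contributes to the coefficient of \<open>t\<close> in
      \<open>q\<close>.\<close>
    have "Poly_Mapping.lookup (h w) t = 0" if "w \<in> Poly_Mapping.keys p" "w \<noteq> t" for w
    proof (rule ccontr)
      assume "Poly_Mapping.lookup (h w) t \<noteq> 0"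
      then have "(t, w) \<in> r"
        using dvd by (intro term_order_dvd r) (simp add: in_keys_iff)
      then show False
        using lead_monom_max(2)[OF r p(2) that(1)] p(3) that(2) term_order_antisym[OF r] by blast
    qed
    then have "Poly_Mapping.lookup q t =
        (\<Sum>w\<in>Poly_Mapping.keys p. if w = t then Poly_Mapping.lookup p t else 0)"
      unfolding q_def lookup_sum lookup_smult by (intro sum.cong) (auto simp: fixed[OF t])
    then have "Poly_Mapping.lookup q t \<noteq> 0"
      using t_key by (simp add: in_keys_iff)
    moreover have "q = 0"
    proof (rule indep)
      have "p - q \<in> I"
        unfolding q_def using cong by (intro poly_ideal_diff_sum_smult I)
      \<comment> \<open>Here \<open>q = p - (p - q)\<close>.\<close>
      then show "q \<in> I"
        using poly_ideal_diff[OF I p(1)] by force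
      show "Poly_Mapping.keys q \<subseteq> S"
        unfolding q_def by (intro keys_sum_smult keys)
    qed
    ultimately show False by simp
  qed
qed

section \<open>From the elimination orders to all term orders\<close>

lemma standard_monoms_eq_elimination:
  fixes ord :: "'n::finite \<Rightarrow> 'n monom rel"
    and I :: "('n, 'a::field) mpol set"
  assumes elim: "\<And>i. elimination_order i (ord i)" and I: "poly_ideal I"
    and S: "\<And>i. standard_monoms (ord i) I = S"
    and r: "term_order r"
  shows "standard_monoms r I = S"
proof -
  have ord: "term_order (ord i)" for i
    using elim by (simp add: elimination_order_def)
  have "\<exists>h. Poly_Mapping.keys h \<subseteq> S \<and> Poly_Mapping.single w 1 - h \<in> I \<and>
    (w \<in> S \<longrightarrow> h = Poly_Mapping.single w 1)" for w
  proof (cases "w \<in> S")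
    case True
    then show ?thesis
      using I by (intro exI[of _ "Poly_Mapping.single w 1"]) (simp add: poly_ideal_def)
  next
    case False
    \<comment> \<open>The index used for the reduction is arbitrary, because \<open>S\<close> is
      common to all \<open>ord i\<close>. One \<open>h\<close> therefore serves every variable at
      once.\<close>
    then show ?thesis
      using ex_normal_form_monom[OF ord I, of _ w] S by simp
  qed
  then obtain h where keys: "\<And>w. Poly_Mapping.keys (h w) \<subseteq> S"
    and cong: "\<And>w. Poly_Mapping.single w 1 - h w \<in> I"
    and fixed: "\<And>w. w \<in> S \<Longrightarrow> h w = Poly_Mapping.single w 1"
    by metis
  have dvd: "Poly_Mapping.lookup s i \<le> Poly_Mapping.lookup w i"
    if s: "s \<in> Poly_Mapping.keys (h w)" for w s i
  proof (cases "w \<in> S")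
    case True
    then show ?thesis using s fixed by simp
  next
    case False
    define g where "g = Poly_Mapping.single w 1 - h w"
    have "w \<notin> Poly_Mapping.keys (h w)" using False keys by blast
    then have w: "w \<in> Poly_Mapping.keys g"
      by (simp add: g_def in_keys_iff lookup_minus)
    then have g: "g \<noteq> 0" by auto
    have "lead_monom (ord i) g \<notin> S"
      using cong[of w] g S[of i] by (auto simp: g_def standard_monoms_def)
    \<comment> \<open>Outside \<open>S\<close> the only possible monomial of \<open>g\<close> is
      \<open>w\<close>, so the nonstandard leading monomial must be \<open>w\<close> for every
      \<open>ord i\<close>.\<close>
    moreover have "Poly_Mapping.keys g \<subseteq> insert w S"
      using keys[of w]
      by (auto simp: g_def subset_iff in_keys_iff lookup_minus lookup_single when_def split: if_splits)
    ultimately have "lead_monom (ord i) g = w"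
      using lead_monom_max(1)[OF ord g, of i] by blast
    moreover have "s \<in> Poly_Mapping.keys g"
      using s \<open>w \<notin> Poly_Mapping.keys (h w)\<close>
      by (auto simp: g_def in_keys_iff lookup_minus lookup_single when_def)
    ultimately have "(s, w) \<in> ord i"
      using lead_monom_max(2)[OF ord g, of s i] by simp
    then show ?thesis using elimination_order_degree[OF elim] by blast
  qed
  have "p = 0" if "p \<in> I" "Poly_Mapping.keys p \<subseteq> S" for p
    using standard_monoms_keysD[OF ord that(1)] that(2) S by blast
  then show ?thesis
    by (intro standard_monoms_eq_if_divisible_normal_forms[OF r I keys cong fixed dvd])
qed

theorem theorem6:
  fixes ord :: "'n::finite \<Rightarrow> 'n monom rel"
    and I :: "('n, 'a::field) mpol set"
  assumes "\<And>i. elimination_order i (ord i)"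
    and "poly_ideal I"
    and "zero_dimensional I"
  shows "(\<forall>r s. term_order r \<longrightarrow> term_order s \<longrightarrow> standard_monoms r I = standard_monoms s I)
     \<longleftrightarrow> (\<forall>i j. standard_monoms (ord i) I = standard_monoms (ord j) I)"
proof
  assume "\<forall>r s. term_order r \<longrightarrow> term_order s \<longrightarrow> standard_monoms r I = standard_monoms s I"
  then show "\<forall>i j. standard_monoms (ord i) I = standard_monoms (ord j) I"
    using assms(1) by (simp add: elimination_order_def)
next
  assume eq: "\<forall>i j. standard_monoms (ord i) I = standard_monoms (ord j) I"
  \<comment> \<open>\<open>undefined\<close> merely names some index; by \<open>eq\<close> its
    choice is immaterial.\<close>
  have "standard_monoms r I = standard_monoms (ord undefined) I" if "term_order r" for r
    using eq by (intro standard_monoms_eq_elimination[OF assms(1,2) _ that]) blast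
  then show "\<forall>r s. term_order r \<longrightarrow> term_order s \<longrightarrow> standard_monoms r I = standard_monoms s I"
    by simp
qed

end
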